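(* The number of distinct samples that can be shattered by a DNN is at least $D+3$, where $D$ is the number of layers. Therefore, the VC-dimension of DNN is lower bounded by $d_{VC}\ge D+3$.
   Context: DNN: there are $D$ hidden layers; for a $d$-dimensional input $\mathbf{x}_0\in[-1,1]^d$, layer $i$ computes $\mathbf{x}_i=\phi(\mathbf{W}_i\mathbf{x}_{i-1}+\mathbf{b}_i)$, $i=1,\dots,D$, where $\mathbf{W}_i$ is a $d\times d$ matrix, $\mathbf{b}_i$ is a $d$-vector, and $\phi$ is an elementwise nonlinear mapping, either the hyperbolic tangent $\tanh$ or the ReLU function $\max\{h,0\}$. The output $\mathbf{x}_D$ of the last hidden layer is fed into a linear classifier with coefficients $\mathbf{w}\in\mathbb{R}^d$ and offset $b\in\mathbb{R}$, and the decision is $\mathrm{sign}(\mathbf{w}^T\mathbf{x}_D+b)\in\{-1,1\}$. The hypothesis set consists of the classifiers obtained by varying the parameters $\mathbf{W}_i,\mathbf{b}_i,\mathbf{w},b$. A set $S$ of $m\ge1$ points is (fully) shattered by a binary hypothesis set $H$ if the hypotheses in $H$ can realize all the $2^m$ possible labelings of $S$; the VC-dimension is $d_{VC}(H)=\max\{|S|:S\text{ is fully shattered by }H\}$.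
   Formalization: The input dimension d is assumed to be at least 2; for d = 1 the claim is false, since the network output is then monotone in the input and no three points can be labelled 1, -1, 1. *)

theory Defs
  imports "HOL-Analysis.Analysis" "HOL-Library.Extended_Nat" "HOL-Library.FuncSet"
begin

definition relu :: "real \<Rightarrow> real" where
  "relu h = max h 0"

(* The library's sgn maps 0 to 0; a binary decision needs a value at 0, fixed here to be 1. *)
definition decision_sign :: "real \<Rightarrow> int" where
  "decision_sign h = (if h \<ge> 0 then 1 else -1)"

definition input_cube :: "(real ^ 'd) set" where
  "input_cube = {x. \<forall>i. x $ i \<in> {-1..1}}"

definition layer :: "(real \<Rightarrow> real) \<Rightarrow> real ^ 'd ^ 'd \<Rightarrow> real ^ 'd \<Rightarrow> real ^ 'd \<Rightarrow> real ^ 'd" where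
  "layer \<phi> A c x = (\<chi> i. \<phi> ((A *v x + c) $ i))"

primrec hidden ::
  "(real \<Rightarrow> real) \<Rightarrow> (nat \<Rightarrow> real ^ 'd ^ 'd) \<Rightarrow> (nat \<Rightarrow> real ^ 'd) \<Rightarrow> real ^ 'd \<Rightarrow> nat \<Rightarrow> real ^ 'd"
where
  "hidden \<phi> W c x0 0 = x0"
| "hidden \<phi> W c x0 (Suc i) = layer \<phi> (W (Suc i)) (c (Suc i)) (hidden \<phi> W c x0 i)"

definition dnn_classifier ::
  "(real \<Rightarrow> real) \<Rightarrow> nat \<Rightarrow> (nat \<Rightarrow> real ^ 'd ^ 'd) \<Rightarrow> (nat \<Rightarrow> real ^ 'd) \<Rightarrow> real ^ 'd \<Rightarrow> real
    \<Rightarrow> real ^ 'd \<Rightarrow> int"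
where
  "dnn_classifier \<phi> D W c w b x0 = decision_sign (w \<bullet> hidden \<phi> W c x0 D + b)"

definition DNN :: "(real \<Rightarrow> real) \<Rightarrow> nat \<Rightarrow> (real ^ 'd \<Rightarrow> int) set" where
  "DNN \<phi> D = {dnn_classifier \<phi> D W c w b | W c w b. True}"

(* X is the input domain: hypotheses are total functions, of which only the values on X matter. *)
definition shattered_by :: "'a set \<Rightarrow> ('a \<Rightarrow> int) set \<Rightarrow> 'a set \<Rightarrow> bool" where
  "shattered_by X H S \<longleftrightarrow>
     S \<subseteq> X \<and> finite S \<and> S \<noteq> {} \<and> (\<forall>y \<in> S \<rightarrow> {-1, 1}. \<exists>h\<in>H. \<forall>x\<in>S. h x = y x)"

(* The supremum in enat is the maximum when it is attained, \<infinity> when shattered sets are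
   arbitrarily large, and 0 when no nonempty set is shattered. *)
definition vc_dim :: "'a set \<Rightarrow> ('a \<Rightarrow> int) set \<Rightarrow> enat" where
  "vc_dim X H = (SUP S \<in> {S. shattered_by X H S}. enat (card S))"

end

theory Submission
  imports Defs
begin

text \<open>
  Two coordinates of the input suffice. By induction on \<open>D\<close> there are \<open>D + 3\<close> points in the half
  plane \<open>x < 1\<close> such that every labelling of them is realized by a network of depth \<open>D\<close> that, in
  addition, takes both signs on the line \<open>x = 1\<close>. To gain a point, prepend a layer acting as
  \<open>(x, y) \<mapsto> (g x, y - s (x - g x))\<close>, where \<open>g\<close> saturates to 1 (\<open>tanh x\<close>, or \<open>min x 1\<close> for ReLU):
  for \<open>s = 0\<close> it sends the \<open>g\<close>-preimages of the old points to the old points, and for a far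
  away new point \<open>(K, 0)\<close> a tiny \<open>s\<close> already moves its image to any prescribed height near the line
  \<open>x = 1\<close>, hence to either sign. Lines \<open>x = c\<close> with \<open>c > K\<close> are mapped onto lines near
  \<open>x = 1\<close> as well, so the new networks again take both signs there; rescaling closes the induction.
\<close>

section \<open>Networks restricted to a coordinate plane and the labellings they realize\<close>

definition labelling_sign :: "'a set \<Rightarrow> 'a \<Rightarrow> real" where
  "labelling_sign T k = (if k \<in> T then 1 else -1)"

text \<open>Common ground for tanh and ReLU. \<open>approx_id\<close> lets a coordinate pass through
  a layer with vanishing error, \<open>saturating\<close> supplies the map called \<open>g\<close>
  above, and \<open>zero\<close> keeps all other coordinates at 0.\<close>

locale planar_network =
  fixes \<phi> :: "real \<Rightarrow> real" and i j :: "'d::finite"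
  assumes neq: "i \<noteq> j"
    and continuous: "continuous_on UNIV \<phi>"
    and zero: "\<phi> 0 = 0"
    and approx_id: "\<exists>\<alpha> \<beta> \<gamma> \<kappa>. \<forall>y. (\<lambda>n::nat. \<alpha> n * \<phi> (\<beta> n * y + \<gamma> n) + \<kappa> n) \<longlonglongrightarrow> y"
    and saturating: "\<exists>\<alpha> \<beta> \<gamma> \<kappa>. ((\<lambda>x. \<alpha> * \<phi> (\<beta> * x + \<gamma>) + \<kappa>) \<longlongrightarrow> 1) at_top \<and>
      {-1<..<1} \<subseteq> range (\<lambda>x. \<alpha> * \<phi> (\<beta> * x + \<gamma>) + \<kappa>)"
begin

definition emb :: "real \<Rightarrow> real \<Rightarrow> real ^ 'd" where
  "emb x y = (\<chi> k. if k = i then x else if k = j then y else 0)"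

definition mat2 :: "real \<Rightarrow> real \<Rightarrow> real \<Rightarrow> real \<Rightarrow> real ^ 'd ^ 'd" where
  "mat2 a b c d = (\<chi> k. if k = i then emb a b else if k = j then emb c d else 0)"

text \<open>Scores before the sign is taken. Only the input is confined to the plane; the weights
  are arbitrary.\<close>

definition planar :: "nat \<Rightarrow> (real \<Rightarrow> real \<Rightarrow> real) set" where
  "planar D = {\<lambda>x y. w \<bullet> hidden \<phi> W c (emb x y) D + b | W c w b. True}"

lemma inner_emb: "emb a b \<bullet> v = a * v $ i + b * v $ j"
proof -
  have "emb a b \<bullet> v = (\<Sum>k\<in>UNIV. (if k = i then a * v $ k else 0) + (if k = j then b * v $ k else 0))"
    unfolding inner_vec_def by (rule sum.cong) (use neq in \<open>auto simp: emb_def\<close>)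
  also have "\<dots> = a * v $ i + b * v $ j"
    by (simp add: sum.distrib)
  finally show ?thesis .
qed

lemma emb_nth [simp]: "emb x y $ i = x" "emb x y $ j = y"
  using neq by (auto simp: emb_def)

lemma emb_add: "emb x y + emb x' y' = emb (x + x') (y + y')"
  by (simp add: vec_eq_iff emb_def)

lemma mat2_mult: "mat2 a b c d *v v = emb (a * v $ i + b * v $ j) (c * v $ i + d * v $ j)"
  by (simp add: vec_eq_iff matrix_vector_mul_component mat2_def emb_def[of _ "_ + _"] inner_emb)

lemma layer_emb:
  "layer \<phi> (mat2 a b c d) (emb p q) (emb x y) = emb (\<phi> (a * x + b * y + p)) (\<phi> (c * x + d * y + q))"
  unfolding layer_def mat2_mult emb_nth emb_add
  by (simp add: vec_eq_iff emb_def zero)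

text \<open>An affine change of the input is absorbed by the first layer or, at depth 0, by the
  linear classifier.\<close>

lemma planar_affine:
  assumes "F \<in> planar D"
  shows "(\<lambda>x y. F (a * x + b * y + p) (c * x + d * y + q)) \<in> planar D"
proof -
  obtain W C w B where F: "F = (\<lambda>x y. w \<bullet> hidden \<phi> W C (emb x y) D + B)"
    using assms unfolding planar_def by auto
  have e: "emb (a * x + b * y + p) (c * x + d * y + q) = mat2 a b c d *v emb x y + emb p q" for x y
    by (simp add: mat2_mult emb_add)
  show ?thesis
  proof (cases D)
    case 0
    have "(\<lambda>x y. F (a * x + b * y + p) (c * x + d * y + q)) =
      (\<lambda>x y. emb (a * w $ i + c * w $ j) (b * w $ i + d * w $ j)
         \<bullet> hidden \<phi> W C (emb x y) D + (w $ i * p + w $ j * q + B))"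
      by (simp add: F 0 inner_emb inner_commute[of w] fun_eq_iff algebra_simps)
    then show ?thesis unfolding planar_def by blast
  next
    case (Suc n)
    define W' where "W' = W(1 := W 1 ** mat2 a b c d)"
    define C' where "C' = C(1 := W 1 *v emb p q + C 1)"
    have l: "layer \<phi> (W' 1) (C' 1) (emb x y) =
      layer \<phi> (W 1) (C 1) (mat2 a b c d *v emb x y + emb p q)" for x y
      by (simp add: layer_def W'_def C'_def matrix_vector_mul_assoc matrix_vector_right_distrib add.assoc)
    have h: "hidden \<phi> W' C' (emb x y) (Suc m) =
      hidden \<phi> W C (mat2 a b c d *v emb x y + emb p q) (Suc m)" for x y m
    proof (induction m)
      case 0
      show ?case using l by simp
    next
      case (Suc m)
      then show ?case by (simp add: W'_def C'_def)
    qed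
    have "(\<lambda>x y. F (a * x + b * y + p) (c * x + d * y + q)) =
      (\<lambda>x y. w \<bullet> hidden \<phi> W' C' (emb x y) D + B)"
      unfolding F e Suc h ..
    then show ?thesis unfolding planar_def by blast
  qed
qed

text \<open>The new layer takes index 1 and the old layers move up by one; by
  \<open>layer_emb\<close> its output stays in the plane.\<close>

lemma planar_layer:
  assumes "F \<in> planar D"
  shows "(\<lambda>x y. F (\<phi> (a * x + b * y + p)) (\<phi> (c * x + d * y + q))) \<in> planar (Suc D)"
proof -
  obtain W C w B where F: "F = (\<lambda>x y. w \<bullet> hidden \<phi> W C (emb x y) D + B)"
    using assms unfolding planar_def by auto
  define W' where "W' = (\<lambda>k. if k = 1 then mat2 a b c d else W (k - 1))"
  define C' where "C' = (\<lambda>k. if k = 1 then emb p q else C (k - 1))"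
  have h: "hidden \<phi> W' C' (emb x y) (Suc m) =
    hidden \<phi> W C (emb (\<phi> (a * x + b * y + p)) (\<phi> (c * x + d * y + q))) m" for x y m
    by (induction m) (auto simp: W'_def C'_def layer_emb)
  have "(\<lambda>x y. F (\<phi> (a * x + b * y + p)) (\<phi> (c * x + d * y + q))) =
    (\<lambda>x y. w \<bullet> hidden \<phi> W' C' (emb x y) (Suc D) + B)"
    unfolding F h ..
  then show ?thesis unfolding planar_def by blast
qed

text \<open>Joint continuity in filter form: strict sign conditions on \<open>F\<close> survive
  small perturbations of its arguments.\<close>

lemma tendsto_planar:
  assumes "F \<in> planar D" "(f \<longlongrightarrow> l) G" "(h \<longlongrightarrow> m) G"
  shows "((\<lambda>z. F (f z) (h z)) \<longlongrightarrow> F l m) G"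
proof -
  obtain W C w B where F: "F = (\<lambda>x y. w \<bullet> hidden \<phi> W C (emb x y) D + B)"
    using assms unfolding planar_def by auto
  have emb: "((\<lambda>z. emb (f z) (h z)) \<longlongrightarrow> emb l m) G"
    by (rule vec_tendstoI) (auto simp: emb_def intro: assms)
  have "((\<lambda>z. hidden \<phi> W C (emb (f z) (h z)) n) \<longlongrightarrow> hidden \<phi> W C (emb l m) n) G" for n
  proof (induction n)
    case 0
    show ?case using emb by simp
  next
    case (Suc n)
    have "((\<lambda>z. \<phi> ((W (Suc n) *v hidden \<phi> W C (emb (f z) (h z)) n + C (Suc n)) $ k)) \<longlongrightarrow>
      \<phi> ((W (Suc n) *v hidden \<phi> W C (emb l m) n + C (Suc n)) $ k)) G" for k
    proof (rule continuous_on_tendsto_compose[OF continuous])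
      show "((\<lambda>z. (W (Suc n) *v hidden \<phi> W C (emb (f z) (h z)) n + C (Suc n)) $ k) \<longlongrightarrow>
        (W (Suc n) *v hidden \<phi> W C (emb l m) n + C (Suc n)) $ k) G"
        by (intro tendsto_vec_nth tendsto_add tendsto_const
            bounded_linear.tendsto[OF matrix_vector_mul_bounded_linear] Suc.IH)
    qed auto
    then show ?case by (simp add: layer_def) (rule vec_tendstoI, simp)
  qed
  then show ?thesis unfolding F by (intro tendsto_intros)
qed

text \<open>The induction invariant. Both signs on the line \<open>x = c\<close> are what lets a
  later point, sent close to that line, receive either label. All inequalities are strict so that
  they survive approximation.\<close>

definition splits :: "nat \<Rightarrow> nat \<Rightarrow> real \<Rightarrow> (nat \<Rightarrow> real) \<Rightarrow> (nat \<Rightarrow> real) \<Rightarrow> bool" where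
  "splits D n c x y \<longleftrightarrow> inj_on (\<lambda>k. (x k, y k)) {..<n} \<and> (\<forall>k<n. x k < c) \<and>
     (\<forall>T. \<exists>F\<in>planar D. (\<forall>k<n. labelling_sign T k * F (x k) (y k) > 0) \<and>
        (\<forall>e\<in>{-1,1}. \<exists>t. e * F c t > 0))"

text \<open>A homothety of ratio \<open>1 / R\<close> takes the line \<open>x = c\<close> to
  \<open>x = 1\<close>. Since \<open>R\<close> exceeds every
  \<open>\<bar>x k - c\<bar> + \<bar>y k\<bar>\<close>, the points land in the open unit square
  around 0, hence within the range of \<open>g\<close> and inside the input cube.\<close>

lemma splits_normalize:
  assumes "splits D n c x y"
  shows "\<exists>x y. splits D n 1 x y \<and> (\<forall>k<n. \<bar>x k\<bar> < 1 \<and> \<bar>y k\<bar> < 1)"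
proof -
  define R where "R = (\<Sum>k<n. \<bar>x k - c\<bar> + \<bar>y k\<bar>) + 1"
  have "\<bar>x k - c\<bar> + \<bar>y k\<bar> \<le> (\<Sum>k<n. \<bar>x k - c\<bar> + \<bar>y k\<bar>)" if "k < n" for k
    by (rule member_le_sum) (use that in auto)
  then have R: "\<bar>x k - c\<bar> + \<bar>y k\<bar> < R" if "k < n" for k
    using that unfolding R_def by fastforce
  have R0: "R > 0" unfolding R_def by (smt (verit) sum_nonneg)
  define x' where "x' = (\<lambda>k. 1 + (x k - c) / R)"
  define y' where "y' = (\<lambda>k. y k / R)"
  have inv: "R * x' k + (c - R) = x k" "R * y' k = y k" for k
    using R0 by (auto simp: x'_def y'_def field_simps)
  have "splits D n 1 x' y'"
    unfolding splits_def
  proof (intro conjI allI impI)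
    show "inj_on (\<lambda>k. (x' k, y' k)) {..<n}"
      using assms inv unfolding splits_def inj_on_def by (metis Pair_inject)
    show "x' k < 1" if "k < n" for k
      using assms that R0 unfolding splits_def x'_def by (simp add: field_simps)
    fix T
    obtain F where F: "F \<in> planar D" "\<forall>k<n. labelling_sign T k * F (x k) (y k) > 0"
      "\<forall>e\<in>{-1,1}. \<exists>t. e * F c t > 0"
      using assms unfolding splits_def by blast
    define G where "G = (\<lambda>x y. F (R * x + 0 * y + (c - R)) (0 * x + R * y + 0))"
    have "G \<in> planar D" unfolding G_def by (rule planar_affine[OF F(1)])
    moreover have "G (x' k) (y' k) = F (x k) (y k)" for k
      unfolding G_def using inv by simp
    moreover have "G 1 (t / R) = F c t" for t
      unfolding G_def using R0 by simp
    ultimately show "\<exists>F\<in>planar D. (\<forall>k<n. labelling_sign T k * F (x' k) (y' k) > 0) \<and>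
        (\<forall>e\<in>{-1,1}. \<exists>t. e * F 1 t > 0)"
      using F(2,3) by metis
  qed
  moreover have "\<bar>x' k\<bar> < 1 \<and> \<bar>y' k\<bar> < 1" if "k < n" for k
    using R[OF that] R0 assms that unfolding x'_def y'_def splits_def
    by (auto simp: field_simps abs_less_iff)
  ultimately show ?thesis by blast
qed

text \<open>Affine functions take arbitrary values at the affinely independent points (0, 0), (1,
  0), (0, 1).\<close>

lemma splits_0: "\<exists>c x y. splits 0 3 c x y"
proof -
  define x :: "nat \<Rightarrow> real" where "x = (\<lambda>k. if k = 1 then 1 else 0)"
  define y :: "nat \<Rightarrow> real" where "y = (\<lambda>k. if k = 2 then 1 else 0)"
  have less3: "k < 3 \<longleftrightarrow> k = 0 \<or> k = 1 \<or> k = 2" for k :: nat by auto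
  have "splits 0 3 2 x y"
    unfolding splits_def
  proof (intro conjI allI impI)
    show "inj_on (\<lambda>k. (x k, y k)) {..<3}"
      by (auto simp: inj_on_def x_def y_def split: if_splits)
    show "x k < 2" for k by (simp add: x_def)
    fix T :: "nat set"
    let ?e = "labelling_sign T"
    \<comment> \<open>The value at (0, 1) is twice its sign, which keeps the coefficient of y nonzero.\<close>
    define b where "b = 2 * ?e 2 - ?e 0"
    have b: "b \<noteq> 0" by (simp add: b_def labelling_sign_def)
    define F where "F = (\<lambda>x y. (?e 1 - ?e 0) * x + b * y + ?e 0)"
    have "F = (\<lambda>x y. emb (?e 1 - ?e 0) b \<bullet> hidden \<phi> W c (emb x y) 0 + ?e 0)" for W c
      by (simp add: F_def inner_emb)
    then have "F \<in> planar 0" unfolding planar_def by blast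
    moreover have "?e k * F (x k) (y k) > 0" if "k < 3" for k
      using that unfolding less3 by (auto simp: F_def x_def y_def b_def labelling_sign_def)
    moreover have "\<exists>t. e * F 2 t > 0" if "e \<in> {-1,1}" for e
    proof
      \<comment> \<open>This height solves \<open>F 2 t = e\<close>, so the product is
        \<open>e * e = 1\<close>.\<close>
      show "e * F 2 ((e - ?e 0 - (?e 1 - ?e 0) * 2) / b) > 0"
        using b that by (auto simp: F_def)
    qed
    ultimately show "\<exists>F\<in>planar 0. (\<forall>k<3. labelling_sign T k * F (x k) (y k) > 0) \<and>
        (\<forall>e\<in>{-1,1}. \<exists>t. e * F 2 t > 0)"
      by blast
  qed
  then show ?thesis by blast
qed

text \<open>The new points are \<open>(a k, y k)\<close> with \<open>g (a k) = x k\<close>, together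
  with \<open>(K, 0)\<close>; the new line is \<open>x = K + 1\<close>. Each labelling works for all
  large \<open>K\<close>, and there are finitely many, so one \<open>K\<close> serves them
  all.\<close>

lemma splits_Suc:
  assumes xy: "splits D n 1 x y" and x1: "\<forall>k<n. \<bar>x k\<bar> < 1"
  shows "\<exists>c x y. splits (Suc D) (Suc n) c x y"
proof -
  obtain \<alpha> \<beta> \<gamma> \<kappa> where sat: "((\<lambda>x. \<alpha> * \<phi> (\<beta> * x + \<gamma>) + \<kappa>) \<longlongrightarrow> 1) at_top"
      "{-1<..<1} \<subseteq> range (\<lambda>x. \<alpha> * \<phi> (\<beta> * x + \<gamma>) + \<kappa>)"
    using saturating by auto
  define g where "g = (\<lambda>x. \<alpha> * \<phi> (\<beta> * x + \<gamma>) + \<kappa>)"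
  have g1: "(g \<longlongrightarrow> 1) at_top" using sat unfolding g_def by simp
  have "\<forall>k. \<exists>a. k < n \<longrightarrow> g a = x k"
    using sat(2) x1 unfolding g_def[symmetric] by (force simp: abs_less_iff)
  then obtain a where a: "\<And>k. k < n \<Longrightarrow> g (a k) = x k" by metis
  \<comment> \<open>One layer realizes (x, y) \<mapsto> (g x, y - s (x - g x)) up to an arbitrarily small error,
    and finitely many strict inequalities survive the error.\<close>
  have realize: "\<exists>G\<in>planar (Suc D). \<forall>(e, u, v)\<in>Q. e * G u v > 0"
    if F: "F \<in> planar D" and Q: "finite Q" "\<forall>(e, u, v)\<in>Q. e * F (g u) (v - s * (u - g u)) > 0"
    for F s and Q :: "(real \<times> real \<times> real) set"
  proof -
    obtain A B C K where id: "\<And>z. (\<lambda>m::nat. A m * \<phi> (B m * z + C m) + K m) \<longlonglongrightarrow> z"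
      using approx_id by metis
    \<comment> \<open>The layer applies \<open>\<phi>\<close> only to affine forms, so the second
      coordinate carries \<open>v - s * u\<close>; the missing \<open>s * g u\<close> is added from
      the first coordinate by an affine map after the layer.\<close>
    define G where "G = (\<lambda>m u v. F (g u) (A m * \<phi> (B m * (v - s * u) + C m) + K m + s * g u))"
    have G: "G m \<in> planar (Suc D)" for m
    proof -
      have "(\<lambda>u v. F (\<alpha> * u + 0 * v + \<kappa>) (s * \<alpha> * u + A m * v + (K m + s * \<kappa>))) \<in> planar D"
        by (rule planar_affine[OF F])
      from planar_layer[OF this, of \<beta> 0 \<gamma> "- B m * s" "B m" "C m"]
      show ?thesis unfolding G_def g_def by (simp add: algebra_simps)
    qed
    have "\<forall>\<^sub>F m in sequentially. (case q of (e, u, v) \<Rightarrow> e * G m u v > 0)" if q: "q \<in> Q" for q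
    proof -
      obtain e u v where [simp]: "q = (e, u, v)" by (cases q)
      have "(\<lambda>m. e * G m u v) \<longlonglongrightarrow> e * F (g u) (v - s * u + s * g u)"
        unfolding G_def by (intro tendsto_intros tendsto_planar[OF F] id)
      moreover have "e * F (g u) (v - s * u + s * g u) > 0"
        using bspec[OF Q(2) q] by (simp add: algebra_simps)
      ultimately show ?thesis by (simp add: order_tendstoD(1))
    qed
    then have "\<forall>\<^sub>F m in sequentially. \<forall>q\<in>Q. (case q of (e, u, v) \<Rightarrow> e * G m u v > 0)"
      using Q(1) by (simp add: eventually_ball_finite)
    then obtain m where "\<forall>q\<in>Q. (case q of (e, u, v) \<Rightarrow> e * G m u v > 0)"
      by (metis (mono_tags, lifting) eventually_happens' sequentially_bot)
    then show ?thesis using G by blast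
  qed
  define good where "good = (\<lambda>K T e0. \<exists>G\<in>planar (Suc D).
      (\<forall>k<n. labelling_sign T k * G (a k) (y k) > 0) \<and> e0 * G K 0 > 0 \<and>
      (\<forall>e\<in>{-1,1}. \<exists>t. e * G (K + 1) t > 0))"
  have good: "\<forall>\<^sub>F K in at_top. good K T e0" if e0: "e0 \<in> {-1,1}" for T and e0 :: real
  proof -
    obtain F where F: "F \<in> planar D" "\<forall>k<n. labelling_sign T k * F (x k) (y k) > 0"
      "\<forall>e\<in>{-1,1}. \<exists>t. e * F 1 t > 0"
      using xy unfolding splits_def by blast
    from F(3) obtain t where t: "\<And>e. e \<in> {-1,1} \<Longrightarrow> e * F 1 (t e) > 0" by metis
    \<comment> \<open>The shear s moves (K, 0) to height t e0; it tends to 0, so the old points are hardly affected.\<close>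
    define s where "s = (\<lambda>K. - t e0 / (K - g K))"
    have Kg: "filterlim (\<lambda>K. K - g K) at_top at_top"
    proof -
      have "filterlim (\<lambda>K. - g K + K) at_top at_top"
        by (rule filterlim_tendsto_add_at_top[OF tendsto_minus[OF g1] filterlim_ident])
      then show ?thesis by simp
    qed
    have s0: "(s \<longlongrightarrow> 0) at_top"
      unfolding s_def by (rule tendsto_divide_0[OF tendsto_const filterlim_at_top_imp_at_infinity[OF Kg]])
    have Kgpos: "\<forall>\<^sub>F K in at_top. K - g K > 0"
      using Kg unfolding filterlim_at_top_dense by blast
    have g1': "((\<lambda>K. g (K + 1)) \<longlongrightarrow> 1) at_top"
      by (rule filterlim_compose[OF g1]) 
         (subst add.commute, rule filterlim_tendsto_add_at_top[OF tendsto_const filterlim_ident])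
    have ev1: "\<forall>\<^sub>F K in at_top. \<forall>k\<in>{..<n}. labelling_sign T k * F (x k) (y k - s K * (a k - x k)) > 0"
    proof (rule eventually_ball_finite, simp, intro ballI)
      fix k assume k: "k \<in> {..<n}"
      have "((\<lambda>K. labelling_sign T k * F (x k) (y k - s K * (a k - x k))) \<longlongrightarrow>
        labelling_sign T k * F (x k) (y k - 0 * (a k - x k))) at_top"
        by (intro tendsto_intros tendsto_planar[OF F(1)] s0)
      then show "\<forall>\<^sub>F K in at_top. labelling_sign T k * F (x k) (y k - s K * (a k - x k)) > 0"
        using F(2) k by (intro order_tendstoD(1)) auto
    qed
    \<comment> \<open>\<open>(K, 0)\<close> is sent to \<open>(g K, t e0)\<close>, which tends to a
      point of the line \<open>x = 1\<close> where \<open>F\<close> has sign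
      \<open>e0\<close>.\<close>
    have ev2: "\<forall>\<^sub>F K in at_top. e0 * F (g K) (t e0) > 0"
    proof (rule order_tendstoD(1))
      show "((\<lambda>K. e0 * F (g K) (t e0)) \<longlongrightarrow> e0 * F 1 (t e0)) at_top"
        by (intro tendsto_intros tendsto_planar[OF F(1)] g1)
    qed (rule t[OF e0])
    have ev3: "\<forall>\<^sub>F K in at_top. e * F (g (K + 1)) (t e) > 0" if "e \<in> {-1,1}" for e
    proof (rule order_tendstoD(1))
      show "((\<lambda>K. e * F (g (K + 1)) (t e)) \<longlongrightarrow> e * F 1 (t e)) at_top"
        by (intro tendsto_intros tendsto_planar[OF F(1)] g1')
    qed (rule t[OF that])
    have ev3': "\<forall>\<^sub>F K in at_top. \<forall>e\<in>{-1,1}. e * F (g (K + 1)) (t e) > 0"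
      by (rule eventually_ball_finite) (use ev3 in auto)
    show ?thesis
      using ev1 ev2 ev3' Kgpos
    proof eventually_elim
      case (elim K)
      \<comment> \<open>\<open>u e\<close> undoes the shear at abscissa \<open>K + 1\<close>: the
        point \<open>(K + 1, u e)\<close> is sent to \<open>(g (K + 1), t e)\<close>.\<close>
      define u where "u = (\<lambda>e. t e + s K * (K + 1 - g (K + 1)))"
      define Q where "Q = (\<lambda>k. (labelling_sign T k, a k, y k)) ` {..<n} \<union> {(e0, K, 0)} \<union>
        (\<lambda>e. (e, K + 1, u e)) ` {-1,1}"
      have "0 - s K * (K - g K) = t e0" using elim(4) by (simp add: s_def)
      then have "\<exists>G\<in>planar (Suc D). \<forall>(e, u, v)\<in>Q. e * G u v > 0"
        by (intro realize[OF F(1), where s = "s K"]) (use elim(1-3) a in \<open>auto simp: Q_def u_def\<close>)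
      then obtain G where G: "G \<in> planar (Suc D)" "\<forall>(e, u, v)\<in>Q. e * G u v > 0"
        by blast
      show "good K T e0"
        unfolding good_def by (rule bexI[OF _ G(1)]) (use G(2) in \<open>auto simp: Q_def\<close>)
    qed
  qed
  \<comment> \<open>The signs at \<open>k < n\<close> depend only on
    \<open>T \<inter> {..<n}\<close>, which leaves finitely many conditions on \<open>K\<close>.
    Taking \<open>K\<close> beyond every \<open>a k\<close> makes the new point distinct and puts
    all points left of \<open>K + 1\<close>.\<close>
  have "\<forall>\<^sub>F K in at_top. \<forall>(T, e0)\<in>Pow {..<n} \<times> {-1,1}. good K T e0"
    by (rule eventually_ball_finite) (use good in auto)
  moreover have "\<forall>\<^sub>F K in at_top. \<forall>k\<in>{..<n}. a k < K"
    by (rule eventually_ball_finite) (auto intro: eventually_gt_at_top)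
  ultimately have "\<forall>\<^sub>F K in at_top. (\<forall>(T, e0)\<in>Pow {..<n} \<times> {-1,1}. good K T e0) \<and> (\<forall>k\<in>{..<n}. a k < K)"
    by (rule eventually_conj)
  then obtain K where K: "\<forall>(T, e0)\<in>Pow {..<n} \<times> {-1,1}. good K T e0" "\<forall>k\<in>{..<n}. a k < K"
    using eventually_happens' trivial_limit_at_top_linorder by (metis (mono_tags, lifting))
  define x' where "x' = a(n := K)"
  define y' where "y' = y(n := 0)"
  have "splits (Suc D) (Suc n) (K + 1) x' y'"
    unfolding splits_def
  proof (intro conjI allI impI)
    have "inj_on (\<lambda>k. (a k, y k)) {..<n}"
      using xy a unfolding splits_def inj_on_def by (metis Pair_inject lessThan_iff)
    then show "inj_on (\<lambda>k. (x' k, y' k)) {..<Suc n}"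
      using K(2) unfolding inj_on_def x'_def y'_def
      by (auto simp: less_Suc_eq)
    show "x' k < K + 1" if "k < Suc n" for k
      using that K(2) unfolding x'_def by (auto simp: less_Suc_eq intro: less_trans)
    fix T
    have "good K (T \<inter> {..<n}) (labelling_sign T n)"
      using K(1) by (auto simp: labelling_sign_def)
    moreover have "labelling_sign (T \<inter> {..<n}) k = labelling_sign T k" if "k < n" for k
      using that by (simp add: labelling_sign_def)
    ultimately show "\<exists>F\<in>planar (Suc D). (\<forall>k<Suc n. labelling_sign T k * F (x' k) (y' k) > 0) \<and>
        (\<forall>e\<in>{-1,1}. \<exists>t. e * F (K + 1) t > 0)"
      unfolding good_def x'_def y'_def by (auto simp: less_Suc_eq)
  qed
  then show ?thesis by blast
qed

lemma ex_splits: "\<exists>x y. splits D (D + 3) 1 x y \<and> (\<forall>k<D + 3. \<bar>x k\<bar> < 1 \<and> \<bar>y k\<bar> < 1)"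
proof (induction D)
  case 0
  show ?case using splits_0 splits_normalize by fastforce
next
  case (Suc D)
  then obtain x y where "splits D (D + 3) 1 x y" "\<forall>k<D + 3. \<bar>x k\<bar> < 1" by blast
  from splits_Suc[OF this] show ?case using splits_normalize by fastforce
qed

text \<open>Strictly signed scores give the desired decisions whatever value
  \<open>decision_sign\<close> has at 0.\<close>

lemma ex_shattered: "\<exists>S :: (real ^ 'd) set. shattered_by input_cube (DNN \<phi> D) S \<and> card S = D + 3"
proof -
  define n where "n = D + 3"
  obtain x y where xy: "splits D n 1 x y" "\<forall>k<n. \<bar>x k\<bar> < 1 \<and> \<bar>y k\<bar> < 1"
    using ex_splits unfolding n_def by blast
  define p where "p = (\<lambda>k. emb (x k) (y k))"
  have inj: "inj_on p {..<n}"
    using xy(1) unfolding splits_def inj_on_def p_def by (metis emb_nth)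
  have cube: "p ` {..<n} \<subseteq> input_cube"
    using xy(2) by (auto simp: p_def input_cube_def emb_def abs_less_iff less_imp_le minus_less_iff)
  have "\<exists>h\<in>DNN \<phi> D. \<forall>v\<in>p ` {..<n}. h v = z v" if z: "z \<in> p ` {..<n} \<rightarrow> {-1, 1}" for z
  proof -
    obtain F where F: "F \<in> planar D"
      "\<forall>k<n. labelling_sign {k. z (p k) = 1} k * F (x k) (y k) > 0"
      using xy(1) unfolding splits_def by blast
    obtain W c w b where F': "F = (\<lambda>x y. w \<bullet> hidden \<phi> W c (emb x y) D + b)"
      using F(1) unfolding planar_def by auto
    have "dnn_classifier \<phi> D W c w b (p k) = z (p k)" if "k < n" for k
    proof -
      have "z (p k) \<in> {-1, 1}" using z that by auto
      then show ?thesis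
        using F(2) that
        by (auto simp: F' dnn_classifier_def decision_sign_def p_def labelling_sign_def split: if_splits)
    qed
    then show ?thesis unfolding DNN_def by blast
  qed
  then have "shattered_by input_cube (DNN \<phi> D) (p ` {..<n})"
    unfolding shattered_by_def using cube by (simp add: n_def lessThan_empty_iff)
  moreover have "card (p ` {..<n}) = D + 3" using card_image[OF inj] by (simp add: n_def)
  ultimately show ?thesis by blast
qed

end

section \<open>The hyperbolic tangent and the ReLU as instances\<close>

lemma tendsto_scaled_tanh: "(\<lambda>n. real n * tanh (inverse (real n) * y)) \<longlonglongrightarrow> y"
proof (cases "y = 0")
  case False
  \<comment> \<open>The slope of tanh at 0 is 1; the difference quotient is then taken along
    \<open>h = y / n\<close>.\<close>
  have "((\<lambda>h. (tanh (0 + h) - tanh 0) / h) \<longlongrightarrow> 1 - tanh 0 ^ 2) (at (0::real))"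
    unfolding DERIV_def[symmetric] by (auto intro!: derivative_eq_intros)
  then have "((\<lambda>h. tanh h / h) \<longlongrightarrow> 1) (at (0::real))" by simp
  moreover have "filterlim (\<lambda>n. inverse (real n) * y) (at 0) sequentially"
    unfolding filterlim_at
    using False tendsto_mult_left_zero[OF lim_inverse_n, of y]
    by (auto intro!: eventually_mono[OF eventually_gt_at_top[of 0]])
  ultimately have "(\<lambda>n. tanh (inverse (real n) * y) / (inverse (real n) * y)) \<longlonglongrightarrow> 1"
    by (rule filterlim_compose)
  from tendsto_mult_right[OF this, of y] show ?thesis
    using False by (simp add: field_simps)
qed simp

lemma tanh_artanh_real:
  fixes x :: real
  assumes "\<bar>x\<bar> < 1"
  shows "tanh (artanh x) = x"
proof -
  have pos: "1 + x > 0" "1 - x > 0" using assms by auto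
  then have e: "exp (- 2 * artanh x) = (1 - x) / (1 + x)"
    by (simp add: artanh_def exp_minus)
  show ?thesis
    unfolding tanh_real_altdef e using pos by (simp add: divide_simps)
qed

lemma planar_network_tanh:
  assumes "i \<noteq> (j :: 'd::finite)"
  shows "planar_network tanh i j"
proof
  show "\<exists>\<alpha> \<beta> \<gamma> \<kappa>. \<forall>y. (\<lambda>n::nat. \<alpha> n * tanh (\<beta> n * y + \<gamma> n) + \<kappa> n) \<longlonglongrightarrow> (y::real)"
    using tendsto_scaled_tanh
    by (intro exI[of _ "\<lambda>n. real n"] exI[of _ "\<lambda>n. inverse (real n)"] exI[of _ "\<lambda>n. 0"]) simp
  have "{-1<..<1} \<subseteq> range (tanh :: real \<Rightarrow> real)"
    by (metis abs_less_iff greaterThanLessThan_iff minus_less_iff rangeI subsetI tanh_artanh_real)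
  then show "\<exists>\<alpha> \<beta> \<gamma> \<kappa>. ((\<lambda>x. \<alpha> * tanh (\<beta> * x + \<gamma>) + \<kappa>) \<longlongrightarrow> (1::real)) at_top \<and>
      {-1<..<1} \<subseteq> range (\<lambda>x. \<alpha> * tanh (\<beta> * x + \<gamma>) + \<kappa>)"
    by (intro exI[of _ 1] exI[of _ 0]) (simp add: tanh_real_at_top)
qed (use assms in \<open>auto intro!: continuous_intros\<close>)

text \<open>Shifting the argument up by \<open>n\<close> and the value back down is exactly the
  identity at \<open>y\<close> once \<open>n \<ge> - y\<close>. The saturating map is
  \<open>1 - relu (1 - x)\<close>, that is \<open>min x 1\<close>.\<close>

lemma planar_network_relu:
  assumes "i \<noteq> (j :: 'd::finite)"
  shows "planar_network relu i j"
proof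
  have "(\<lambda>n. relu (y + real n) - real n) \<longlonglongrightarrow> y" for y
  proof (rule tendsto_eventually)
    show "\<forall>\<^sub>F n in sequentially. relu (y + real n) - real n = y"
      using eventually_ge_at_top[of "nat \<lceil>- y\<rceil>"]
    proof eventually_elim
      case (elim n)
      then have "- y \<le> real n" by linarith
      then show ?case by (simp add: relu_def)
    qed
  qed
  then show "\<exists>\<alpha> \<beta> \<gamma> \<kappa>. \<forall>y. (\<lambda>n::nat. \<alpha> n * relu (\<beta> n * y + \<gamma> n) + \<kappa> n) \<longlonglongrightarrow> y"
    by (intro exI[of _ "\<lambda>n. 1"] exI[of _ "\<lambda>n. real n"] exI[of _ "\<lambda>n. - real n"]) simp
  have "((\<lambda>x. - relu (1 - x) + 1) \<longlongrightarrow> 1) at_top"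
    by (rule tendsto_eventually, rule eventually_mono[OF eventually_ge_at_top[of 1]])
       (simp add: relu_def)
  moreover have "{-1<..<1} \<subseteq> range (\<lambda>x. - relu (1 - x) + 1)"
  proof
    fix x :: real assume "x \<in> {-1<..<1}"
    then show "x \<in> range (\<lambda>x. - relu (1 - x) + 1)"
      by (intro image_eqI[of _ _ x]) (auto simp: relu_def)
  qed
  ultimately show "\<exists>\<alpha> \<beta> \<gamma> \<kappa>. ((\<lambda>x. \<alpha> * relu (\<beta> * x + \<gamma>) + \<kappa>) \<longlongrightarrow> 1) at_top \<and>
      {-1<..<1} \<subseteq> range (\<lambda>x. \<alpha> * relu (\<beta> * x + \<gamma>) + \<kappa>)"
    by (intro exI[of _ "-1"] exI[of _ 1]) simp
qed (use assms in \<open>auto intro!: continuous_intros simp: relu_def[abs_def]\<close>)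

section \<open>The lower bound on the VC-dimension\<close>

theorem theorem7:
  fixes \<phi> :: "real \<Rightarrow> real" and D :: nat
  assumes "\<phi> = tanh \<or> \<phi> = relu"
    and "CARD('d::finite) \<ge> 2"
  shows "(\<exists>S :: (real ^ 'd) set. shattered_by input_cube (DNN \<phi> D) S \<and> card S \<ge> D + 3)
    \<and> vc_dim (input_cube :: (real ^ 'd) set) (DNN \<phi> D) \<ge> enat (D + 3)"
proof -
  obtain i j :: 'd where "i \<noteq> j"
    using assms(2) by (metis (full_types) One_nat_def card_1_singleton_iff is_singletonI' is_singleton_def
        UNIV_not_empty not_less_eq_eq numeral_2_eq_2 order_refl)
  then have "planar_network \<phi> i j"
    using assms(1) planar_network_tanh planar_network_relu by blast
  then obtain S :: "(real ^ 'd) set" where S: "shattered_by input_cube (DNN \<phi> D) S" "card S = D + 3"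
    using planar_network.ex_shattered by blast
  then have "enat (D + 3) \<le> vc_dim (input_cube :: (real ^ 'd) set) (DNN \<phi> D)"
    unfolding vc_dim_def by (metis (mono_tags, lifting) SUP_upper mem_Collect_eq)
  with S show ?thesis by (metis order_refl)
qed

end
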